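(* Assume (Increments), (Waiting times) and (Integrability) as described in the context. For $\gamma<0$ let $\bar\lambda^\gamma$ be the constant of a solution $(\bar v^\gamma,\bar\lambda^\gamma)\in\mathcal{C}_b(\mathcal{S})\times\mathbb{R}$ of the Bellman equation $(B_\gamma)$ of the context, and let $\bar\lambda^0:=\lim_{\gamma\uparrow0}\bar\lambda^\gamma$. Then there exists $\bar v^0\in\mathcal{C}_b(\mathcal{S})$ such that $(\bar v^0,\bar\lambda^0)$ is a solution to the Bellman equation with $\gamma=0$, i.e. $$\bar v^0(\pi)=\sup_{\pi'\in\mathcal{S}}\Big(\ln s(\pi,\pi')-\bar\lambda^0\,\mathbb{E}[\eta_1]+\mathbb{E}\big[\ln\langle \pi',R(\eta_1)\rangle+\bar v^0(G(\pi',R(\eta_1)))\big]\Big),\qquad \pi\in\mathcal{S}.$$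
   Context: Notation. $d\ge1$; $\langle x,y\rangle$ is the scalar product, $x\cdot y$ the component-wise product on $\mathbb{R}^d$; $\mathbf{1}=(1,\dots,1)$. $\mathcal{S}=\{\pi\in\mathbb{R}^d:\pi_i\ge0,\ \langle\pi,\mathbf{1}\rangle=1\}$; $\mathcal{C}_b(\mathcal{S})$ is the space of bounded continuous real functions on $\mathcal{S}$. $G(x,y):=\frac{x\cdot y}{\langle x,y\rangle}$. Transaction costs. $c_i,h_i\in[0,1)$, $i=1,\dots,d$; $p(x):=\sum_{i=1}^d\max(c_ix_i,-h_ix_i)$. For $\pi,\pi'\in\mathcal{S}$, $s(\pi,\pi')$ denotes the unique $w>0$ with $w+p(w\pi'-\pi)=1$. Market. $S(t)=(S_1(t),\dots,S_d(t))$, $t\ge0$, is a process of strictly positive prices, $R(t_1,t_2)=(S_i(t_2)/S_i(t_1))_{i}$, $R(t)=R(0,t)$, $r(t)=\ln R(t)$ (component-wise). $(\eta_i)_{i\ge1}$ are i.i.d. $(0,\infty)$-valued random variables, independent of the price process. (Increments): $t\mapsto\ln S(t)$ is right-continuous and has stationary independent increments. (Waiting times): $\mathbb{P}[\eta_i>0]=1$ and $\mathbb{E}[\eta_i]<\infty$. (Integrability): for any $\gamma<0$, $\mathbb{E}[e^{\gamma\min_i r_i(\eta_1)}]<\infty$, and $\mathbb{E}[\max_i r_i(\eta_1)]<\infty$. Entropic utility. $\mu^\gamma[Z]:=\frac1\gamma\ln\mathbb{E}[e^{\gamma Z}]$ for $\gamma<0$ and $\mu^0[Z]:=\mathbb{E}[Z]$.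 Bellman equation $(B_\gamma)$, $\gamma\le 0$: $$\bar v^\gamma(\pi)=\sup_{\pi'\in\mathcal{S}}\Big(\ln s(\pi,\pi')-\bar\lambda^\gamma\,\mathbb{E}[\eta_1]+\mu^\gamma\big[\ln\langle \pi',R(\eta_1)\rangle+\bar v^\gamma(G(\pi',R(\eta_1)))\big]\Big),\qquad \pi\in\mathcal{S}.$$ Facts which make $\bar\lambda^0$ well defined: under the three conditions a solution of $(B_\gamma)$ in $\mathcal{C}_b(\mathcal{S})\times\mathbb{R}$ exists for each $\gamma<0$; the constant $\bar\lambda^\gamma$ does not depend on the choice of the solution (it is the optimal value of a long-run control problem) and is non-decreasing in $\gamma$. *)

theory Defs
  imports "HOL-Probability.Probability"
begin

unbundle vec_syntax

definition prob_simplex :: "(real ^ 'n) set" where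
  "prob_simplex = {x. (\<forall>i. 0 \<le> x $ i) \<and> inner x 1 = 1}"

text \<open>The product \<open>x * y\<close> on \<^typ>\<open>real ^ 'n\<close> is component-wise.\<close>

definition G :: "real ^ 'n \<Rightarrow> real ^ 'n \<Rightarrow> real ^ 'n" where
  "G x y = (x * y) /\<^sub>R inner x y"

definition penalty :: "real ^ 'n \<Rightarrow> real ^ 'n \<Rightarrow> real ^ 'n \<Rightarrow> real" where
  "penalty c h x = (\<Sum>i\<in>UNIV. max (c $ i * x $ i) (- h $ i * x $ i))"

text \<open>For \<open>c\<^sub>i, h\<^sub>i \<in> [0,1)\<close> and \<open>\<pi>, \<pi>'\<close> in \<open>prob_simplex\<close> the map
  \<open>w \<mapsto> w + penalty c h (w \<pi>' - \<pi>)\<close> is strictly increasing and continuous, is below 1 at 0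
  and unbounded, so the description below is well defined.\<close>

definition shrink :: "real ^ 'n \<Rightarrow> real ^ 'n \<Rightarrow> real ^ 'n \<Rightarrow> real ^ 'n \<Rightarrow> real" where
  "shrink c h \<pi> \<pi>' = (THE w. 0 < w \<and> w + penalty c h (w *\<^sub>R \<pi>' - \<pi>) = 1)"

definition vec_ln :: "real ^ 'n \<Rightarrow> real ^ 'n" where
  "vec_ln x = (\<chi> i. ln (x $ i))"

definition price_rel :: "(real \<Rightarrow> 'w \<Rightarrow> real ^ 'n) \<Rightarrow> real \<Rightarrow> real \<Rightarrow> 'w \<Rightarrow> real ^ 'n" where
  "price_rel S t\<^sub>1 t\<^sub>2 \<omega> = (\<chi> i. S t\<^sub>2 \<omega> $ i / S t\<^sub>1 \<omega> $ i)"

definition log_price_rel :: "(real \<Rightarrow> 'w \<Rightarrow> real ^ 'n) \<Rightarrow> real \<Rightarrow> 'w \<Rightarrow> real ^ 'n" where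
  "log_price_rel S t \<omega> = vec_ln (price_rel S 0 t \<omega>)"

text \<open>Processes are indexed by all reals for typing reasons; only times \<open>t \<ge> 0\<close> and waiting
  times \<open>\<eta> i\<close> with \<open>i \<ge> 1\<close> are constrained or used.\<close>

definition price_process :: "'w measure \<Rightarrow> (real \<Rightarrow> 'w \<Rightarrow> real ^ 'n) \<Rightarrow> bool" where
  "price_process M S \<longleftrightarrow>
     (\<forall>t\<ge>0. S t \<in> borel_measurable M) \<and>
     (\<forall>t\<ge>0. \<forall>\<omega>\<in>space M. \<forall>i. 0 < S t \<omega> $ i)"

definition iid_positive :: "'w measure \<Rightarrow> (nat \<Rightarrow> 'w \<Rightarrow> real) \<Rightarrow> bool" where
  "iid_positive M \<eta> \<longleftrightarrow>
     prob_space.indep_vars M (\<lambda>_. borel) \<eta> {1..} \<and>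
     (\<forall>i\<ge>1. distr M borel (\<eta> i) = distr M borel (\<eta> 1)) \<and>
     (\<forall>i\<ge>1. \<forall>\<omega>\<in>space M. 0 < \<eta> i \<omega>)"

text \<open>The sigma-algebra generated by the whole sequence of waiting times is independent of the one
  generated by the whole price process. (\<^const>\<open>prob_space.indep_var\<close> would need both random
  elements to have the same type.)\<close>

definition indep_of_prices ::
    "'w measure \<Rightarrow> (real \<Rightarrow> 'w \<Rightarrow> real ^ 'n) \<Rightarrow> (nat \<Rightarrow> 'w \<Rightarrow> real) \<Rightarrow> bool" where
  "indep_of_prices M S \<eta> \<longleftrightarrow>
     prob_space.indep_set M
       {(\<lambda>\<omega>. \<lambda>i\<in>{1..}. \<eta> i \<omega>) -` A \<inter> space M | A. A \<in> sets (Pi\<^sub>M {1..} (\<lambda>_. borel))}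
       {(\<lambda>\<omega>. \<lambda>t\<in>{0..}. S t \<omega>) -` B \<inter> space M | B. B \<in> sets (Pi\<^sub>M {0..} (\<lambda>_. borel))}"

definition stationary_increments :: "'w measure \<Rightarrow> (real \<Rightarrow> 'w \<Rightarrow> real ^ 'n) \<Rightarrow> bool" where
  "stationary_increments M X \<longleftrightarrow>
     (\<forall>s\<ge>0. \<forall>t\<ge>0. distr M borel (\<lambda>\<omega>. X (s + t) \<omega> - X s \<omega>)
                  = distr M borel (\<lambda>\<omega>. X t \<omega> - X 0 \<omega>))"

definition independent_increments :: "'w measure \<Rightarrow> (real \<Rightarrow> 'w \<Rightarrow> real ^ 'n) \<Rightarrow> bool" where
  "independent_increments M X \<longleftrightarrow>
     (\<forall>(n::nat) (t::nat \<Rightarrow> real). 0 \<le> t 0 \<longrightarrow> (\<forall>k<n. t k < t (Suc k)) \<longrightarrow>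
        prob_space.indep_vars M (\<lambda>_. borel) (\<lambda>k \<omega>. X (t (Suc k)) \<omega> - X (t k) \<omega>) {..<n})"

definition increments_cond :: "'w measure \<Rightarrow> (real \<Rightarrow> 'w \<Rightarrow> real ^ 'n) \<Rightarrow> bool" where
  "increments_cond M S \<longleftrightarrow>
     (\<forall>\<omega>\<in>space M. \<forall>t\<ge>0. continuous (at_right t) (\<lambda>u. vec_ln (S u \<omega>))) \<and>
     stationary_increments M (\<lambda>t \<omega>. vec_ln (S t \<omega>)) \<and>
     independent_increments M (\<lambda>t \<omega>. vec_ln (S t \<omega>))"

definition waiting_cond :: "'w measure \<Rightarrow> (nat \<Rightarrow> 'w \<Rightarrow> real) \<Rightarrow> bool" where
  "waiting_cond M \<eta> \<longleftrightarrow>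
     (\<forall>i\<ge>1. measure M {\<omega>\<in>space M. 0 < \<eta> i \<omega>} = 1 \<and> integrable M (\<eta> i))"

text \<open>By the first condition \<open>min\<^sub>i r\<^sub>i(\<eta>\<^sub>1)\<close>, hence also \<open>max\<^sub>i r\<^sub>i(\<eta>\<^sub>1)\<close>, has integrable negative
  part, so finiteness of the expectation of the maximum (a priori in \<open>[-\<infinity>,\<infinity>]\<close>) amounts to
  integrability.\<close>

definition integrability_cond ::
    "'w measure \<Rightarrow> (real \<Rightarrow> 'w \<Rightarrow> real ^ 'n) \<Rightarrow> (nat \<Rightarrow> 'w \<Rightarrow> real) \<Rightarrow> bool" where
  "integrability_cond M S \<eta> \<longleftrightarrow>
     (\<forall>\<gamma><0. integrable M (\<lambda>\<omega>. exp (\<gamma> * (MIN i. log_price_rel S (\<eta> 1 \<omega>) \<omega> $ i)))) \<and>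
     integrable M (\<lambda>\<omega>. MAX i. log_price_rel S (\<eta> 1 \<omega>) \<omega> $ i)"

text \<open>Only used for \<open>\<gamma> \<le> 0\<close>.\<close>

definition entropic :: "'w measure \<Rightarrow> real \<Rightarrow> ('w \<Rightarrow> real) \<Rightarrow> real" where
  "entropic M \<gamma> Z =
     (if \<gamma> = 0 then \<integral>\<omega>. Z \<omega> \<partial>M else 1 / \<gamma> * ln (\<integral>\<omega>. exp (\<gamma> * Z \<omega>) \<partial>M))"

definition Cb :: "(real ^ 'n) set \<Rightarrow> (real ^ 'n \<Rightarrow> real) set" where
  "Cb A = {v. continuous_on A v \<and> bounded (v ` A)}"

text \<open>Under the market conditions, for \<open>\<gamma> \<le> 0\<close> and \<open>v \<in> Cb prob_simplex\<close>, all expectations below are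
  of integrable functions and the supremum is over a nonempty set of reals that is bounded above
  (by \<open>- \<lambda> E[\<eta>\<^sub>1] + E[max\<^sub>i r\<^sub>i(\<eta>\<^sub>1)] + sup v\<close>), so it is the genuine supremum.\<close>

definition bellman_solution ::
    "'w measure \<Rightarrow> (real \<Rightarrow> 'w \<Rightarrow> real ^ 'n) \<Rightarrow> (nat \<Rightarrow> 'w \<Rightarrow> real) \<Rightarrow> real ^ 'n \<Rightarrow> real ^ 'n
      \<Rightarrow> real \<Rightarrow> (real ^ 'n \<Rightarrow> real) \<Rightarrow> real \<Rightarrow> bool" where
  "bellman_solution M S \<eta> c h \<gamma> v lam \<longleftrightarrow>
     v \<in> Cb prob_simplex \<and>
     (\<forall>\<pi>\<in>prob_simplex. v \<pi> =
        (SUP \<pi>'\<in>prob_simplex.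
           ln (shrink c h \<pi> \<pi>') - lam * (\<integral>\<omega>. \<eta> 1 \<omega> \<partial>M)
           + entropic M \<gamma> (\<lambda>\<omega>. ln (inner \<pi>' (price_rel S 0 (\<eta> 1 \<omega>) \<omega>))
                               + v (G \<pi>' (price_rel S 0 (\<eta> 1 \<omega>) \<omega>)))))"

end

theory Submission
  imports Defs "HOL-Complex_Analysis.Great_Picard"
begin

text \<open>The proof is a vanishing risk-aversion argument. The price process enters the Bellman
  equation through the random vector \<open>R\<close> of gross returns over one waiting period, whose
  measurability follows from right-continuity (\<open>random_time_measurable\<close>); from there on the market
  is represented by \<open>R\<close>.

  A solution of the equation says that \<open>v \<pi> + l\<close>, where \<open>l = lam * E \<eta>\<close>, is the least upper bound
  over \<open>\<pi>'\<close> of \<open>ln s(\<pi>,\<pi>') + reward \<gamma> v \<pi>'\<close>. The reward is monotone in \<open>v\<close>, commutes with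
  the addition of constants to \<open>v\<close>, and increases with \<open>\<gamma>\<close>. Evaluating two solutions at a point
  where their difference is maximal therefore shows that \<open>l\<close> is non-decreasing in \<open>\<gamma>\<close>
  (\<open>solves_constant_mono\<close>), and since trading costs are non-negative, \<open>l\<close> is at most the expected
  largest log-return (\<open>solves_constant_le\<close>). Hence \<open>lam\<close> has a finite limit at \<open>0\<close> from the left.

  The current position \<open>\<pi>\<close> enters the maximised expression only through \<open>ln s(\<pi>,\<pi>')\<close>. As all
  cost rates are below one, \<open>s\<close> is bounded away from \<open>0\<close> and \<open>ln s\<close> is Lipschitz in \<open>\<pi>\<close>,
  uniformly in \<open>\<pi>'\<close> (\<open>ln_shrink_le\<close>), so every solution is Lipschitz with one constant that does
  not depend on \<open>\<gamma>\<close> (\<open>solves_lipschitz\<close>). Solutions normalised to vanish at one point are thus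
  equicontinuous and bounded on the compact simplex, and the Arzela-Ascoli theorem gives a uniform
  limit \<open>v\<^sub>0\<close> along a sequence \<open>\<gamma> \<rightarrow> 0\<close>.

  It remains to pass to the limit in the equation (\<open>solves_limit\<close>). Replacing the approximating
  solution by \<open>v\<^sub>0\<close> costs a uniformly small error. That \<open>v\<^sub>0 \<pi> + l\<close> is an upper bound then needs
  the convergence of the entropic utility to the expectation only for each \<open>\<pi>'\<close> separately, and
  that it is the least one needs only that the entropic utility never exceeds the expectation;
  uniform convergence in \<open>\<pi>'\<close> is avoided.\<close>

section \<open>Entropic utility\<close>

definition exp_moments :: "'w measure \<Rightarrow> ('w \<Rightarrow> real) \<Rightarrow> bool" where
  "exp_moments M Z \<longleftrightarrow> integrable M Z \<and> (\<forall>\<gamma><0. integrable M (\<lambda>\<omega>. exp (\<gamma> * Z \<omega>)))"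

text \<open>The difference quotient of \<open>\<gamma> \<mapsto> exp (\<gamma> z)\<close> at \<open>0\<close>, continued by its limit. The entropic
  utility is the certainty equivalent of this utility function; expectations of \<open>exp_quotient\<close>
  carry no outer logarithm, which makes them easier to compare for different \<open>\<gamma>\<close>.\<close>

definition exp_quotient :: "real \<Rightarrow> real \<Rightarrow> real" where
  "exp_quotient \<gamma> z = (if \<gamma> = 0 then z else (exp (\<gamma> * z) - 1) / \<gamma>)"

text \<open>Chords of the convex function \<open>exp\<close> through the point over \<open>0\<close> have increasing slopes.\<close>

lemma exp_quotient_mono:
  assumes "\<gamma> \<le> \<gamma>'" "\<gamma>' \<le> 0"
  shows "exp_quotient \<gamma> z \<le> exp_quotient \<gamma>' z"
proof (cases "\<gamma>' = 0")
  case True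
  show ?thesis
  proof (cases "\<gamma> = 0")
    case False
    then have "\<gamma> < 0" using assms by simp
    moreover have "\<gamma> * z \<le> exp (\<gamma> * z) - 1"
      using exp_ge_add_one_self[of "\<gamma> * z"] by linarith
    ultimately show ?thesis using True
      by (simp add: exp_quotient_def divide_le_eq mult.commute)
  qed (simp add: True)
next
  case False
  then have neg: "\<gamma>' < 0" "\<gamma> < 0" using assms by auto
  define t where "t = \<gamma>' / \<gamma>"
  define x where "x = \<gamma>' * z"
  have t: "0 \<le> t" "t \<le> 1" "t * \<gamma> = \<gamma>'" using neg assms by (auto simp: t_def field_simps)
  \<comment> \<open>Both \<open>\<gamma> z\<close> and \<open>0\<close> are compared with the tangent of \<open>exp\<close> at \<open>\<gamma>' z\<close>.\<close>
  have tangent: "exp x * (1 + (y - x)) \<le> exp y" for y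
    using mult_left_mono[OF exp_ge_add_one_self[of "y - x"], of "exp x"]
    by (simp add: exp_add[symmetric])
  have "exp x = t * (exp x * (1 + (\<gamma> * z - x))) + (1 - t) * (exp x * (1 + (0 - x)))"
    unfolding x_def t(3)[symmetric] by (simp add: algebra_simps)
  also have "\<dots> \<le> t * exp (\<gamma> * z) + (1 - t) * exp 0"
    using t by (intro add_mono mult_left_mono tangent) auto
  finally have "exp x - 1 \<le> t * (exp (\<gamma> * z) - 1)" by (simp add: algebra_simps)
  then have "t * (exp (\<gamma> * z) - 1) / \<gamma>' \<le> (exp x - 1) / \<gamma>'"
    using neg by (intro divide_right_mono_neg) auto
  then show ?thesis using neg by (simp add: exp_quotient_def x_def t_def)
qed

lemma exp_quotient_tendsto:
  assumes "g \<longlonglongrightarrow> 0" "\<And>n. g n < 0"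
  shows "(\<lambda>n. exp_quotient (g n) z) \<longlonglongrightarrow> z"
proof -
  have "((\<lambda>\<gamma>. exp (\<gamma> * z)) has_real_derivative z) (at 0)"
    by (auto intro!: derivative_eq_intros)
  then have "((\<lambda>\<gamma>. (exp (\<gamma> * z) - 1) / \<gamma>) \<longlongrightarrow> z) (at 0)"
    by (simp add: DERIV_def)
  moreover have "filterlim g (at 0) sequentially"
    using assms by (auto simp: filterlim_at less_imp_neq)
  ultimately have "(\<lambda>n. (exp (g n * z) - 1) / g n) \<longlonglongrightarrow> z"
    by (rule filterlim_compose)
  then show ?thesis
    using assms(2) by (simp add: exp_quotient_def less_imp_neq)
qed

context prob_space
begin

lemma exp_moments_add_const:
  assumes "exp_moments M Z"
  shows "exp_moments M (\<lambda>\<omega>. Z \<omega> + b)"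
  using assms by (auto simp: exp_moments_def distrib_left exp_add)

lemma integrable_exp_quotient:
  assumes "exp_moments M Z" "\<gamma> \<le> 0"
  shows "integrable M (\<lambda>\<omega>. exp_quotient \<gamma> (Z \<omega>))"
  using assms by (cases "\<gamma> = 0") (auto simp: exp_moments_def exp_quotient_def)

text \<open>Describing the entropic utility by the amounts \<open>b\<close> that lie below it turns its monotonicity
  in \<open>Z\<close> and in \<open>\<gamma>\<close>, its translation equivariance and its limit as \<open>\<gamma> \<rightarrow> 0\<close> into statements
  about expectations of \<open>exp_quotient\<close>, and it treats \<open>\<gamma> = 0\<close> on the same footing.\<close>

lemma le_entropic_iff:
  assumes Z: "exp_moments M Z" and "\<gamma> \<le> 0"
  shows "b \<le> entropic M \<gamma> Z \<longleftrightarrow> 0 \<le> expectation (\<lambda>\<omega>. exp_quotient \<gamma> (Z \<omega> - b))"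
proof (cases "\<gamma> = 0")
  case True
  then show ?thesis using Z
    by (simp add: entropic_def exp_quotient_def exp_moments_def prob_space)
next
  case False
  then have neg: "\<gamma> < 0" using assms by simp
  have int: "integrable M (\<lambda>\<omega>. exp (\<gamma> * Z \<omega>))"
    using Z neg by (simp add: exp_moments_def)
  define e where "e = expectation (\<lambda>\<omega>. exp (\<gamma> * Z \<omega>))"
  have pos: "0 < e"
    unfolding e_def using int by (intro expectation_greater) auto
  have eq: "exp_quotient \<gamma> (Z \<omega> - b) = (exp (\<gamma> * Z \<omega>) * exp (- \<gamma> * b) - 1) / \<gamma>" for \<omega>
    using neg by (simp add: exp_quotient_def exp_add[symmetric] algebra_simps)
  have "expectation (\<lambda>\<omega>. exp_quotient \<gamma> (Z \<omega> - b)) = (e * exp (- \<gamma> * b) - 1) / \<gamma>"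
    unfolding eq using int by (simp add: prob_space e_def)
  also have "0 \<le> \<dots> \<longleftrightarrow> e * exp (- \<gamma> * b) \<le> 1"
    using neg by (simp add: zero_le_divide_iff)
  also have "\<dots> \<longleftrightarrow> e \<le> exp (\<gamma> * b)"
    by (simp add: exp_minus field_simps)
  also have "\<dots> \<longleftrightarrow> ln e \<le> \<gamma> * b"
    using pos by (metis exp_le_cancel_iff exp_ln)
  also have "\<dots> \<longleftrightarrow> b \<le> entropic M \<gamma> Z"
    using neg by (simp add: entropic_def e_def le_divide_eq mult.commute)
  finally show ?thesis by simp
qed

text \<open>Notable cases: \<open>\<gamma>' = 0\<close> with \<open>Z = Z'\<close> is Jensen's inequality, \<open>\<gamma> = \<gamma>'\<close> is monotonicity and
  translation equivariance, and \<open>Z = Z'\<close> with \<open>k = 0\<close> says that the utility decreases with risk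
  aversion.\<close>

lemma entropic_mono:
  assumes Z: "exp_moments M Z" and Z': "exp_moments M Z'"
    and le: "\<And>\<omega>. \<omega> \<in> space M \<Longrightarrow> Z \<omega> \<le> Z' \<omega> + k"
    and \<gamma>: "\<gamma> \<le> \<gamma>'" "\<gamma>' \<le> 0"
  shows "entropic M \<gamma> Z \<le> entropic M \<gamma>' Z' + k"
proof -
  have mono: "exp_quotient \<gamma> x \<le> exp_quotient \<gamma>' y" if "x \<le> y" for x y
  proof -
    have "exp_quotient \<gamma> x \<le> exp_quotient \<gamma>' x" by (intro exp_quotient_mono \<gamma>)
    also have "\<dots> \<le> exp_quotient \<gamma>' y"
      using that \<gamma> by (auto simp: exp_quotient_def mult_left_mono_neg intro!: divide_right_mono_neg)
    finally show ?thesis .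
  qed
  define b where "b = entropic M \<gamma> Z"
  have "0 \<le> expectation (\<lambda>\<omega>. exp_quotient \<gamma> (Z \<omega> - b))"
    using le_entropic_iff[OF Z, of \<gamma> b] \<gamma> by (simp add: b_def)
  also have "\<dots> \<le> expectation (\<lambda>\<omega>. exp_quotient \<gamma>' (Z' \<omega> - (b - k)))"
  proof (rule integral_mono)
    show "integrable M (\<lambda>\<omega>. exp_quotient \<gamma> (Z \<omega> - b))"
      using integrable_exp_quotient[OF exp_moments_add_const[OF Z, of "-b"], of \<gamma>] \<gamma> by simp
    show "integrable M (\<lambda>\<omega>. exp_quotient \<gamma>' (Z' \<omega> - (b - k)))"
      using integrable_exp_quotient[OF exp_moments_add_const[OF Z', of "k - b"], of \<gamma>'] \<gamma>
      by (simp add: algebra_simps)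
  next
    fix \<omega> assume "\<omega> \<in> space M"
    then show "exp_quotient \<gamma> (Z \<omega> - b) \<le> exp_quotient \<gamma>' (Z' \<omega> - (b - k))"
      using le by (intro mono) (auto simp: algebra_simps)
  qed
  finally have "b - k \<le> entropic M \<gamma>' Z'"
    using le_entropic_iff[OF Z'] \<gamma> by simp
  then show ?thesis by (simp add: b_def)
qed

text \<open>The upper estimate is Jensen's inequality. For the lower one, an amount \<open>b\<close> below the
  expectation is eventually below the entropic utility, because the expectation of
  \<open>exp_quotient \<gamma> (Z - b)\<close> tends to that of \<open>Z - b\<close>, which is positive.\<close>

lemma entropic_tendsto_expectation:
  assumes Z: "exp_moments M Z"
    and g: "g \<longlonglongrightarrow> 0" "\<And>n. g n < 0"
  shows "(\<lambda>n. entropic M (g n) Z) \<longlonglongrightarrow> expectation Z"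
proof (rule order_tendstoI)
  fix a assume "expectation Z < a"
  moreover have "entropic M (g n) Z \<le> expectation Z" for n
    using entropic_mono[OF Z Z, of 0 "g n" 0] g(2)[of n] by (simp add: entropic_def)
  ultimately show "\<forall>\<^sub>F n in sequentially. entropic M (g n) Z < a"
    by (auto intro: always_eventually le_less_trans)
next
  fix a assume "a < expectation Z"
  then obtain b where b: "a < b" "b < expectation Z" using dense by blast
  define Y where "Y \<omega> = Z \<omega> - b" for \<omega>
  have Y: "exp_moments M Y"
    using exp_moments_add_const[OF Z, of "-b"] by (simp add: Y_def[abs_def])
  have g1: "\<forall>\<^sub>F n in sequentially. -1 \<le> g n"
    using order_tendstoD(1)[OF g(1), of "-1"] by (auto elim: eventually_mono)
  then obtain N where N: "-1 \<le> g n" if "n \<ge> N" for n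
    by (auto simp: eventually_sequentially)
  \<comment> \<open>For \<open>-1 \<le> \<gamma> \<le> 0\<close> the quotient lies between its values \<open>1 - exp (-z)\<close> and \<open>z\<close> at the
    two ends, which are integrable.\<close>
  have "(\<lambda>n. expectation (\<lambda>\<omega>. exp_quotient (g (n + N)) (Y \<omega>))) \<longlonglongrightarrow> expectation Y"
  proof (rule integral_dominated_convergence)
    show "integrable M (\<lambda>\<omega>. \<bar>Y \<omega>\<bar> + (1 + exp (-1 * Y \<omega>)))"
    proof -
      have "integrable M Y" "integrable M (\<lambda>\<omega>. exp (-1 * Y \<omega>))"
        using Y unfolding exp_moments_def by (blast, metis neg_less_0_iff_less zero_less_one)
      then show ?thesis by (intro Bochner_Integration.integrable_add) auto
    qed
    show "AE \<omega> in M. (\<lambda>n. exp_quotient (g (n + N)) (Y \<omega>)) \<longlonglongrightarrow> Y \<omega>"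
      using g by (intro AE_I2 exp_quotient_tendsto LIMSEQ_ignore_initial_segment) auto
    show "AE \<omega> in M. norm (exp_quotient (g (n + N)) (Y \<omega>)) \<le> \<bar>Y \<omega>\<bar> + (1 + exp (-1 * Y \<omega>))" for n
    proof (rule AE_I2)
      fix \<omega>
      have "exp_quotient (g (n + N)) (Y \<omega>) \<le> exp_quotient 0 (Y \<omega>)"
        using g(2) by (intro exp_quotient_mono) (auto intro: less_imp_le)
      moreover have "exp_quotient (-1) (Y \<omega>) \<le> exp_quotient (g (n + N)) (Y \<omega>)"
        using g(2) N[of "n + N"] by (intro exp_quotient_mono) (auto intro: less_imp_le)
      moreover have "0 < exp (- Y \<omega>)" by simp
      ultimately show "norm (exp_quotient (g (n + N)) (Y \<omega>)) \<le> \<bar>Y \<omega>\<bar> + (1 + exp (-1 * Y \<omega>))"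
        unfolding exp_quotient_def[of 0] exp_quotient_def[of "-1"] real_norm_def
        by (simp del: exp_gt_zero)
    qed
    show "Y \<in> borel_measurable M"
      using Y by (auto simp: exp_moments_def)
    show "(\<lambda>\<omega>. exp_quotient (g (n + N)) (Y \<omega>)) \<in> borel_measurable M" for n
      using integrable_exp_quotient[OF Y] g(2) less_imp_le by blast
  qed
  then have "(\<lambda>n. expectation (\<lambda>\<omega>. exp_quotient (g n) (Y \<omega>))) \<longlonglongrightarrow> expectation Y"
    by (rule LIMSEQ_offset)
  moreover have "0 < expectation Y"
    unfolding Y_def[abs_def] using b Z by (simp add: exp_moments_def prob_space)
  ultimately have "\<forall>\<^sub>F n in sequentially. 0 < expectation (\<lambda>\<omega>. exp_quotient (g n) (Y \<omega>))"
    by (rule order_tendstoD(1))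
  then show "\<forall>\<^sub>F n in sequentially. a < entropic M (g n) Z"
  proof (rule eventually_mono)
    fix n assume "0 < expectation (\<lambda>\<omega>. exp_quotient (g n) (Y \<omega>))"
    then have "b \<le> entropic M (g n) Z"
      using le_entropic_iff[OF Z, of "g n" b] g(2)[of n] by (simp add: Y_def)
    then show "a < entropic M (g n) Z" using b by simp
  qed
qed

end

section \<open>The simplex of portfolio weights\<close>

lemma simplex_nonneg: "\<pi> \<in> prob_simplex \<Longrightarrow> 0 \<le> \<pi> $ i"
  by (simp add: prob_simplex_def)

lemma simplex_sum: "\<pi> \<in> prob_simplex \<Longrightarrow> (\<Sum>i\<in>UNIV. \<pi> $ i) = 1"
  by (simp add: prob_simplex_def inner_vec_def)

lemma axis_in_simplex: "axis i 1 \<in> (prob_simplex :: (real ^ 'n) set)"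
  by (auto simp: prob_simplex_def axis_def inner_vec_def if_distrib cong: if_cong)

lemma simplex_nonempty: "(prob_simplex :: (real ^ 'n) set) \<noteq> {}"
  using axis_in_simplex by blast

lemma compact_simplex: "compact (prob_simplex :: (real ^ 'n) set)"
  unfolding compact_eq_bounded_closed
proof
  show "bounded (prob_simplex :: (real ^ 'n) set)"
  proof (rule boundedI)
    fix x :: "real ^ 'n" assume x: "x \<in> prob_simplex"
    have "norm x \<le> (\<Sum>i\<in>UNIV. \<bar>x $ i\<bar>)" by (rule norm_le_l1_cart)
    also have "\<dots> = 1" using x simplex_nonneg[OF x] simplex_sum[OF x] by simp
    finally show "norm x \<le> 1" .
  qed
  have "closed {x :: real ^ 'n. inner x 1 = 1}" "closed {x :: real ^ 'n. 0 \<le> x $ i}" for i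
    by (intro closed_Collect_eq closed_Collect_le continuous_intros)+
  then have "closed ((\<Inter>i. {x :: real ^ 'n. 0 \<le> x $ i}) \<inter> {x. inner x 1 = 1})"
    by (intro closed_Int closed_INT ballI)
  also have "(\<Inter>i. {x :: real ^ 'n. 0 \<le> x $ i}) \<inter> {x. inner x 1 = 1} = prob_simplex"
    by (auto simp: prob_simplex_def)
  finally show "closed (prob_simplex :: (real ^ 'n) set)" .
qed

section \<open>The shrinkage factor\<close>

locale transaction_costs =
  fixes c h :: "real ^ 'n"
  assumes c: "0 \<le> c $ i" "c $ i < 1"
    and h: "0 \<le> h $ i" "h $ i < 1"
begin

definition hbar :: real where "hbar = (MAX i. h $ i)"

lemma h_le_hbar: "h $ i \<le> hbar"
  unfolding hbar_def by (intro Max_ge) auto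

lemma hbar_less_1: "hbar < 1"
  unfolding hbar_def using h(2) by (subst Max_less_iff) auto

lemma penalty_nonneg: "0 \<le> penalty c h x"
  unfolding penalty_def
proof (intro sum_nonneg)
  fix i
  show "0 \<le> max (c $ i * x $ i) (- h $ i * x $ i)"
    using c[of i] h[of i] mult_nonneg_nonneg[of "c $ i" "x $ i"] mult_nonneg_nonpos[of "h $ i" "x $ i"]
    by (cases "0 \<le> x $ i") (auto simp: le_max_iff_disj)
qed

lemma penalty_diff_le: "penalty c h x - penalty c h y \<le> (\<Sum>i\<in>UNIV. \<bar>x $ i - y $ i\<bar>)"
  unfolding penalty_def sum_subtractf[symmetric]
proof (intro sum_mono)
  fix i
  have "\<bar>c $ i * (x $ i - y $ i)\<bar> \<le> \<bar>x $ i - y $ i\<bar>"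
      "\<bar>h $ i * (x $ i - y $ i)\<bar> \<le> \<bar>x $ i - y $ i\<bar>"
    using c[of i] h[of i] by (simp_all add: abs_mult mult_left_le_one_le)
  then show "max (c $ i * x $ i) (- h $ i * x $ i) - max (c $ i * y $ i) (- h $ i * y $ i) \<le> \<bar>x $ i - y $ i\<bar>"
    by (simp add: algebra_simps) linarith
qed

text \<open>When \<open>w\<close> grows, the penalty can fall only where less of an asset is sold, and then by at most
  \<open>hbar\<close> per unit; so the left-hand side of the equation for the shrinkage factor has slope at least
  \<open>1 - hbar\<close> in \<open>w\<close>. This gives uniqueness of the root and its Lipschitz dependence on \<open>\<pi>\<close>.\<close>

lemma shrink_eq_increasing:
  assumes "\<pi>' \<in> prob_simplex" "w \<le> w'"
  shows "(1 - hbar) * (w' - w)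
    \<le> (w' + penalty c h (w' *\<^sub>R \<pi>' - \<pi>)) - (w + penalty c h (w *\<^sub>R \<pi>' - \<pi>))"
proof -
  have comp: "max (c $ i * a) (- h $ i * a) - hbar * d \<le> max (c $ i * (a + d)) (- h $ i * (a + d))"
    if "0 \<le> d" for i a d
  proof -
    have "h $ i * d \<le> hbar * d" "0 \<le> c $ i * d" "0 \<le> h $ i * d"
      using that h_le_hbar[of i] c[of i] h[of i] by (auto intro: mult_right_mono)
    then show ?thesis by (simp add: algebra_simps) linarith
  qed
  have "penalty c h (w *\<^sub>R \<pi>' - \<pi>) - (\<Sum>i\<in>UNIV. hbar * ((w' - w) * \<pi>' $ i))
      \<le> penalty c h (w' *\<^sub>R \<pi>' - \<pi>)"
    unfolding penalty_def sum_subtractf[symmetric]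
  proof (intro sum_mono)
    fix i
    have eq: "(w' *\<^sub>R \<pi>' - \<pi>) $ i = (w *\<^sub>R \<pi>' - \<pi>) $ i + (w' - w) * \<pi>' $ i"
      by (simp add: algebra_simps)
    show "max (c $ i * (w *\<^sub>R \<pi>' - \<pi>) $ i) (- h $ i * (w *\<^sub>R \<pi>' - \<pi>) $ i)
        - hbar * ((w' - w) * \<pi>' $ i)
        \<le> max (c $ i * (w' *\<^sub>R \<pi>' - \<pi>) $ i) (- h $ i * (w' *\<^sub>R \<pi>' - \<pi>) $ i)"
      unfolding eq by (rule comp) (use assms simplex_nonneg[of \<pi>' i] in simp)
  qed
  moreover have "(\<Sum>i\<in>UNIV. hbar * ((w' - w) * \<pi>' $ i)) = hbar * (w' - w)"
    using simplex_sum[OF assms(1)] by (simp add: sum_distrib_left[symmetric])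
  ultimately show ?thesis by (simp add: algebra_simps)
qed

text \<open>The root lies in \<open>(0, 1]\<close> by the intermediate value theorem: at \<open>w = 0\<close> everything is sold and
  the cost is at most \<open>hbar < 1\<close>, while at \<open>w = 1\<close> the penalty is non-negative. From \<open>0\<close> to the
  root the left-hand side gains at least \<open>1 - hbar\<close> and its slope is at most \<open>2\<close>, whence the lower
  bound.\<close>

lemma shrink_properties:
  assumes \<pi>: "\<pi> \<in> prob_simplex" and \<pi>': "\<pi>' \<in> prob_simplex"
  shows "shrink c h \<pi> \<pi>' + penalty c h (shrink c h \<pi> \<pi>' *\<^sub>R \<pi>' - \<pi>) = 1" (is "?root")
    and "(1 - hbar) / 2 \<le> shrink c h \<pi> \<pi>'" (is "?lower")
    and "shrink c h \<pi> \<pi>' \<le> 1" (is "?upper")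
proof -
  define f where "f w = w + penalty c h (w *\<^sub>R \<pi>' - \<pi>)" for w
  have incr: "(1 - hbar) * (w' - w) \<le> f w' - f w" if "w \<le> w'" for w w'
    unfolding f_def by (rule shrink_eq_increasing[OF \<pi>' that])
  have "f 0 = (\<Sum>i\<in>UNIV. max (- (c $ i * \<pi> $ i)) (h $ i * \<pi> $ i))"
    by (simp add: f_def penalty_def)
  also have "\<dots> \<le> (\<Sum>i\<in>UNIV. hbar * \<pi> $ i)"
  proof (intro sum_mono)
    fix i
    have "0 \<le> \<pi> $ i" using \<pi> by (rule simplex_nonneg)
    then have "h $ i * \<pi> $ i \<le> hbar * \<pi> $ i" "0 \<le> c $ i * \<pi> $ i" "0 \<le> h $ i * \<pi> $ i"
      using h_le_hbar[of i] c[of i] h[of i] by (auto intro: mult_right_mono)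
    then show "max (- (c $ i * \<pi> $ i)) (h $ i * \<pi> $ i) \<le> hbar * \<pi> $ i" by simp
  qed
  finally have f0: "f 0 \<le> hbar"
    using simplex_sum[OF \<pi>] by (simp add: sum_distrib_left[symmetric])
  have "\<exists>w\<ge>0. w \<le> 1 \<and> f w = 1"
  proof (rule IVT')
    show "f 0 \<le> 1" using f0 hbar_less_1 by simp
    show "1 \<le> f 1" using penalty_nonneg by (simp add: f_def)
    show "continuous_on {0..1} f"
      unfolding f_def penalty_def by (intro continuous_intros)
  qed auto
  then obtain s where s: "0 \<le> s" "s \<le> 1" "f s = 1" by blast
  have "s \<noteq> 0" using s f0 hbar_less_1 by auto
  then have s0: "0 < s" using s by simp
  have shrink: "shrink c h \<pi> \<pi>' = s"
    unfolding shrink_def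
  proof (rule the_equality)
    show "0 < s \<and> s + penalty c h (s *\<^sub>R \<pi>' - \<pi>) = 1" using s s0 by (simp add: f_def)
    fix w assume "0 < w \<and> w + penalty c h (w *\<^sub>R \<pi>' - \<pi>) = 1"
    then have fw: "f w = 1" by (simp add: f_def)
    show "w = s"
    proof (rule ccontr)
      assume "w \<noteq> s"
      then have "0 < (1 - hbar) * \<bar>w - s\<bar>" using hbar_less_1 by simp
      then show False using incr[of w s] incr[of s w] fw s(3) by (auto simp: abs_if split: if_splits)
    qed
  qed
  show ?root using s(3) by (simp add: shrink f_def)
  show ?upper using s by (simp add: shrink)
  have "f s - f 0 \<le> s + (\<Sum>i\<in>UNIV. \<bar>(s *\<^sub>R \<pi>' - \<pi>) $ i - (0 *\<^sub>R \<pi>' - \<pi>) $ i\<bar>)"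
    unfolding f_def using penalty_diff_le[of "s *\<^sub>R \<pi>' - \<pi>" "0 *\<^sub>R \<pi>' - \<pi>"] by simp
  also have "(\<Sum>i\<in>UNIV. \<bar>(s *\<^sub>R \<pi>' - \<pi>) $ i - (0 *\<^sub>R \<pi>' - \<pi>) $ i\<bar>) = (\<Sum>i\<in>UNIV. s * \<pi>' $ i)"
    using s0 simplex_nonneg[OF \<pi>'] by (intro sum.cong) auto
  also have "\<dots> = s" using simplex_sum[OF \<pi>'] by (simp add: sum_distrib_left[symmetric])
  finally show ?lower using s(3) f0 by (simp add: shrink)
qed

lemma shrink_pos:
  assumes "\<pi> \<in> prob_simplex" "\<pi>' \<in> prob_simplex"
  shows "0 < shrink c h \<pi> \<pi>'"
  using shrink_properties(2)[OF assms] hbar_less_1 by simp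

lemma ln_shrink_nonpos:
  assumes "\<pi> \<in> prob_simplex" "\<pi>' \<in> prob_simplex"
  shows "ln (shrink c h \<pi> \<pi>') \<le> 0"
  using shrink_properties(3)[OF assms] shrink_pos[OF assms] by simp

text \<open>One factor \<open>1 - hbar\<close> comes from the slope of the equation for the shrinkage factor, the other,
  together with the \<open>2\<close>, from the lower bound of the shrinkage factor under the logarithm; the
  dimension compares the 1-norm with the Euclidean norm.\<close>

definition lip :: real where "lip = 2 * real CARD('n) / (1 - hbar)\<^sup>2"

lemma lip_pos: "0 < lip"
  using hbar_less_1 by (simp add: lip_def)

lemma ln_shrink_le:
  assumes \<pi>: "\<pi> \<in> prob_simplex" and \<rho>: "\<rho> \<in> prob_simplex" and \<pi>': "\<pi>' \<in> prob_simplex"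
  shows "ln (shrink c h \<pi> \<pi>') \<le> ln (shrink c h \<rho> \<pi>') + lip * dist \<pi> \<rho>"
proof -
  define s t where "s = shrink c h \<pi> \<pi>'" and "t = shrink c h \<rho> \<pi>'"
  have pos: "0 < s" "0 < t" using shrink_pos assms by (auto simp: s_def t_def)
  have q: "0 < 1 - hbar" using hbar_less_1 by simp
  have l1: "(\<Sum>i\<in>UNIV. \<bar>(s *\<^sub>R \<pi>' - \<rho>) $ i - (s *\<^sub>R \<pi>' - \<pi>) $ i\<bar>) \<le> real CARD('n) * dist \<pi> \<rho>"
  proof -
    have "(\<Sum>i\<in>UNIV. \<bar>(s *\<^sub>R \<pi>' - \<rho>) $ i - (s *\<^sub>R \<pi>' - \<pi>) $ i\<bar>) \<le> (\<Sum>i\<in>(UNIV::'n set). dist \<pi> \<rho>)"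
      by (intro sum_mono) (use component_le_norm_cart[of "\<pi> - \<rho>"] in \<open>simp add: dist_norm\<close>)
    then show ?thesis by simp
  qed
  have diff: "(1 - hbar) * (s - t) \<le> real CARD('n) * dist \<pi> \<rho>"
  proof (cases "t \<le> s")
    case True
    have "(1 - hbar) * (s - t) \<le> (s + penalty c h (s *\<^sub>R \<pi>' - \<rho>)) - (t + penalty c h (t *\<^sub>R \<pi>' - \<rho>))"
      by (rule shrink_eq_increasing[OF \<pi>' True])
    also have "t + penalty c h (t *\<^sub>R \<pi>' - \<rho>) = s + penalty c h (s *\<^sub>R \<pi>' - \<pi>)"
      using shrink_properties(1)[OF \<rho> \<pi>'] shrink_properties(1)[OF \<pi> \<pi>']
      by (simp add: s_def t_def)
    finally show ?thesis
      using penalty_diff_le[of "s *\<^sub>R \<pi>' - \<rho>" "s *\<^sub>R \<pi>' - \<pi>"] l1 by linarith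
  next
    case False
    then have "(1 - hbar) * (s - t) \<le> 0" using q by (simp add: mult_le_0_iff)
    also have "\<dots> \<le> real CARD('n) * dist \<pi> \<rho>" by simp
    finally show ?thesis .
  qed
  have tl: "(1 - hbar) / 2 \<le> t" unfolding t_def by (rule shrink_properties(2)[OF \<rho> \<pi>'])
  have "ln s - ln t = ln (s / t)" using pos by (simp add: ln_div)
  also have "\<dots> \<le> s / t - 1" using pos by (intro ln_le_minus_one) auto
  also have "\<dots> = (s - t) / t" using pos by (simp add: diff_divide_distrib)
  also have "\<dots> \<le> (real CARD('n) * dist \<pi> \<rho> / (1 - hbar)) / t"
    using diff q pos by (intro divide_right_mono) (auto simp: le_divide_eq mult.commute)
  also have "\<dots> \<le> (real CARD('n) * dist \<pi> \<rho> / (1 - hbar)) / ((1 - hbar) / 2)"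
    using tl q pos by (intro divide_left_mono) auto
  also have "\<dots> = lip * dist \<pi> \<rho>"
    by (simp add: lip_def power2_eq_square)
  finally show ?thesis by (simp add: s_def t_def)
qed

end

section \<open>Prices observed at a random time\<close>

lemma borel_measurable_vec:
  fixes f :: "'w \<Rightarrow> real ^ 'n"
  assumes "\<And>i. (\<lambda>\<omega>. f \<omega> $ i) \<in> borel_measurable M"
  shows "f \<in> borel_measurable M"
proof (subst borel_measurable_euclidean_space, intro ballI)
  fix b :: "real ^ 'n" assume "b \<in> Basis"
  then obtain i where b: "b = axis i 1" by (auto simp: Basis_vec_def)
  show "(\<lambda>\<omega>. inner (f \<omega>) b) \<in> borel_measurable M"
    unfolding b inner_axis using assms[of i] by simp
qed

lemma borel_measurable_vec_component:
  fixes f :: "'w \<Rightarrow> real ^ 'n"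
  assumes "f \<in> borel_measurable M"
  shows "(\<lambda>\<omega>. f \<omega> $ i) \<in> borel_measurable M"
  using assms by (rule measurable_compose) (intro borel_measurable_continuous_onI continuous_intros)

text \<open>A right-continuous process need only be known at countably many times: \<open>T\<close> is approximated
  strictly from above by the grid times \<open>(\<lfloor>nT\<rfloor> + 1) / n\<close>.\<close>

lemma random_time_measurable:
  fixes X :: "real \<Rightarrow> 'w \<Rightarrow> 'b::metric_space"
  assumes X: "\<And>t. 0 \<le> t \<Longrightarrow> X t \<in> borel_measurable M"
    and rc: "\<And>\<omega> t. \<omega> \<in> space M \<Longrightarrow> 0 \<le> t \<Longrightarrow> continuous (at_right t) (\<lambda>u. X u \<omega>)"
    and T: "T \<in> borel_measurable M" "\<And>\<omega>. \<omega> \<in> space M \<Longrightarrow> 0 \<le> T \<omega>"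
  shows "(\<lambda>\<omega>. X (T \<omega>) \<omega>) \<in> borel_measurable M"
proof (rule borel_measurable_LIMSEQ_metric)
  define k where "k n \<omega> = nat \<lfloor>T \<omega> * real (Suc n)\<rfloor>" for n \<omega>
  define t where "t n j = real (Suc j) / real (Suc n)" for n j
  show "(\<lambda>\<omega>. X (t n (k n \<omega>)) \<omega>) \<in> borel_measurable M" for n
  proof (rule measurable_compose_countable)
    show "X (t n j) \<in> borel_measurable M" for j by (intro X) (simp add: t_def)
    show "k n \<in> measurable M (count_space UNIV)"
      unfolding k_def[abs_def] using T(1) by measurable
  qed
  fix \<omega> assume \<omega>: "\<omega> \<in> space M"
  have bounds: "T \<omega> < t n (k n \<omega>) \<and> t n (k n \<omega>) \<le> T \<omega> + 1 / real (Suc n)" for n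
  proof -
    have "real (k n \<omega>) = of_int \<lfloor>T \<omega> * real (Suc n)\<rfloor>"
      using T(2)[OF \<omega>] by (simp add: k_def)
    then have "T \<omega> * real (Suc n) < real (k n \<omega>) + 1" "real (k n \<omega>) \<le> T \<omega> * real (Suc n)"
      by linarith+
    then have "T \<omega> * real (Suc n) < real (Suc (k n \<omega>))"
      "real (Suc (k n \<omega>)) \<le> (T \<omega> + 1 / real (Suc n)) * real (Suc n)"
      by (simp_all add: distrib_right)
    then show ?thesis unfolding t_def by (simp add: pos_less_divide_eq pos_divide_le_eq)
  qed
  have "(\<lambda>n. T \<omega> + 1 / real (Suc n)) \<longlonglongrightarrow> T \<omega> + 0"
    by (intro tendsto_add tendsto_const LIMSEQ_Suc[OF lim_1_over_n])
  then have upper: "(\<lambda>n. T \<omega> + 1 / real (Suc n)) \<longlonglongrightarrow> T \<omega>" by simp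
  have "(\<lambda>n. t n (k n \<omega>)) \<longlonglongrightarrow> T \<omega>"
    by (rule tendsto_sandwich[OF _ _ tendsto_const upper])
      (intro always_eventually allI; use bounds in \<open>blast intro: less_imp_le\<close>)+
  then have "filterlim (\<lambda>n. t n (k n \<omega>)) (at_right (T \<omega>)) sequentially"
    using bounds unfolding filterlim_at
    by (auto simp: less_imp_neq[THEN not_sym] intro!: always_eventually)
  moreover have "((\<lambda>u. X u \<omega>) \<longlongrightarrow> X (T \<omega>) \<omega>) (at_right (T \<omega>))"
    using rc[OF \<omega> T(2)[OF \<omega>]] by (simp add: continuous_within)
  ultimately show "(\<lambda>n. X (t n (k n \<omega>)) \<omega>) \<longlonglongrightarrow> X (T \<omega>) \<omega>"
    by (rule filterlim_compose[rotated])
qed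

text \<open>The continuity assumption concerns the logarithms of the prices, hence the detour through
  \<open>exp (ln _)\<close>.\<close>

lemma price_rel_measurable:
  fixes S :: "real \<Rightarrow> 'w \<Rightarrow> real ^ 'n"
  assumes S: "price_process M S" and inc: "increments_cond M S"
    and T: "T \<in> borel_measurable M" "\<And>\<omega>. \<omega> \<in> space M \<Longrightarrow> 0 \<le> T \<omega>"
  shows "(\<lambda>\<omega>. price_rel S 0 (T \<omega>) \<omega>) \<in> borel_measurable M"
proof -
  have comp: "(\<lambda>\<omega>. S t \<omega> $ i) \<in> borel_measurable M" if "0 \<le> t" for t i
    using S that by (intro borel_measurable_vec_component) (simp add: price_process_def)
  have pos: "0 < S t \<omega> $ i" if "0 \<le> t" "\<omega> \<in> space M" for t \<omega> i
    using S that by (auto simp: price_process_def)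
  have "(\<lambda>\<omega>. ln (S (T \<omega>) \<omega> $ i)) \<in> borel_measurable M" for i
  proof (rule random_time_measurable[where X = "\<lambda>t \<omega>. ln (S t \<omega> $ i)", OF _ _ T])
    show "(\<lambda>\<omega>. ln (S t \<omega> $ i)) \<in> borel_measurable M" if "0 \<le> t" for t
      using comp[OF that, of i] by measurable
    fix \<omega> t assume "\<omega> \<in> space M" "0 \<le> (t::real)"
    then have "continuous (at_right t) (\<lambda>u. vec_ln (S u \<omega>))"
      using inc by (simp add: increments_cond_def)
    then have "continuous (at_right t) (\<lambda>u. vec_ln (S u \<omega>) $ i)"
      unfolding continuous_within by (rule tendsto_vec_nth)
    then show "continuous (at_right t) (\<lambda>u. ln (S u \<omega> $ i))"
      by (simp add: vec_ln_def)
  qed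
  then have "(\<lambda>\<omega>. exp (ln (S (T \<omega>) \<omega> $ i)) / S 0 \<omega> $ i) \<in> borel_measurable M" for i
    using comp[of 0 i] by measurable
  then have quot: "(\<lambda>\<omega>. S (T \<omega>) \<omega> $ i / S 0 \<omega> $ i) \<in> borel_measurable M" for i
    by (subst measurable_cong[where g = "\<lambda>\<omega>. exp (ln (S (T \<omega>) \<omega> $ i)) / S 0 \<omega> $ i"])
       (simp_all add: pos T)
  show ?thesis
    by (intro borel_measurable_vec) (simp add: price_rel_def quot)
qed

section \<open>Growth of wealth over one waiting period\<close>

text \<open>The market seen over a single waiting period: \<open>R \<omega>\<close> stands for the vector of gross returns,
  and the two integrability assumptions are those on its log-returns.\<close>

locale growth_market = prob_space M + transaction_costs c h
  for M :: "'w measure" and c h :: "real ^ 'n" +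
  fixes R :: "'w \<Rightarrow> real ^ 'n"
  assumes R_measurable: "R \<in> borel_measurable M"
    and R_pos: "\<omega> \<in> space M \<Longrightarrow> 0 < R \<omega> $ i"
    and min_exp_integrable: "\<gamma> < 0 \<Longrightarrow> integrable M (\<lambda>\<omega>. exp (\<gamma> * (MIN i. ln (R \<omega> $ i))))"
    and max_integrable: "integrable M (\<lambda>\<omega>. MAX i. ln (R \<omega> $ i))"
begin

definition lo :: "'w \<Rightarrow> real" where "lo \<omega> = (MIN i. ln (R \<omega> $ i))"
definition hi :: "'w \<Rightarrow> real" where "hi \<omega> = (MAX i. ln (R \<omega> $ i))"

lemma inner_R_pos:
  assumes "\<pi> \<in> prob_simplex" "\<omega> \<in> space M"
  shows "0 < inner \<pi> (R \<omega>)"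
    and "exp (lo \<omega>) \<le> inner \<pi> (R \<omega>)"
    and "inner \<pi> (R \<omega>) \<le> exp (hi \<omega>)"
proof -
  have sum: "(\<Sum>i\<in>UNIV. \<pi> $ i * a) = a" for a
    using simplex_sum[OF assms(1)] by (simp add: sum_distrib_right[symmetric])
  have R: "exp (lo \<omega>) \<le> R \<omega> $ i" "R \<omega> $ i \<le> exp (hi \<omega>)" for i
  proof -
    have "lo \<omega> \<le> ln (R \<omega> $ i)" "ln (R \<omega> $ i) \<le> hi \<omega>"
      by (auto simp: lo_def hi_def)
    then show "exp (lo \<omega>) \<le> R \<omega> $ i" "R \<omega> $ i \<le> exp (hi \<omega>)"
      using R_pos[OF assms(2), of i] by (metis exp_le_cancel_iff exp_ln)+
  qed
  have "(\<Sum>i\<in>UNIV. \<pi> $ i * exp (lo \<omega>)) \<le> inner \<pi> (R \<omega>)"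
    unfolding inner_vec_def inner_real_def
    by (intro sum_mono mult_left_mono R simplex_nonneg assms)
  then show lo: "exp (lo \<omega>) \<le> inner \<pi> (R \<omega>)" by (simp only: sum)
  then show "0 < inner \<pi> (R \<omega>)" using exp_gt_zero less_le_trans by blast
  have "inner \<pi> (R \<omega>) \<le> (\<Sum>i\<in>UNIV. \<pi> $ i * exp (hi \<omega>))"
    unfolding inner_vec_def inner_real_def
    by (intro sum_mono mult_left_mono R simplex_nonneg assms)
  then show "inner \<pi> (R \<omega>) \<le> exp (hi \<omega>)" by (simp only: sum)
qed

lemma ln_inner_R_bounds:
  assumes "\<pi> \<in> prob_simplex" "\<omega> \<in> space M"
  shows "lo \<omega> \<le> ln (inner \<pi> (R \<omega>))" "ln (inner \<pi> (R \<omega>)) \<le> hi \<omega>"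
  using inner_R_pos[OF assms] ln_le_cancel_iff[of "inner \<pi> (R \<omega>)" "exp (hi \<omega>)"]
  by (simp_all add: ln_ge_iff)

lemma G_in_simplex:
  assumes "\<pi> \<in> prob_simplex" "\<omega> \<in> space M"
  shows "G \<pi> (R \<omega>) \<in> prob_simplex"
proof -
  have pos: "0 < inner \<pi> (R \<omega>)" by (rule inner_R_pos[OF assms])
  have "inner (\<pi> * R \<omega>) 1 = inner \<pi> (R \<omega>)"
    by (simp add: inner_vec_def)
  then have "inner (G \<pi> (R \<omega>)) 1 = 1"
    using pos by (simp add: G_def)
  moreover have "0 \<le> G \<pi> (R \<omega>) $ i" for i
    using pos R_pos[OF assms(2), of i] simplex_nonneg[OF assms(1), of i]
    by (simp add: G_def)
  ultimately show ?thesis by (simp add: prob_simplex_def)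
qed

definition log_wealth :: "(real ^ 'n \<Rightarrow> real) \<Rightarrow> real ^ 'n \<Rightarrow> 'w \<Rightarrow> real" where
  "log_wealth v \<pi> \<omega> = ln (inner \<pi> (R \<omega>)) + v (G \<pi> (R \<omega>))"

definition reward :: "real \<Rightarrow> (real ^ 'n \<Rightarrow> real) \<Rightarrow> real ^ 'n \<Rightarrow> real" where
  "reward \<gamma> v \<pi> = entropic M \<gamma> (log_wealth v \<pi>)"

lemma log_wealth_measurable:
  assumes v: "v \<in> Cb prob_simplex" and \<pi>: "\<pi> \<in> prob_simplex"
  shows "log_wealth v \<pi> \<in> borel_measurable M"
proof -
  note R_measurable [measurable]
  have comp: "(\<lambda>\<omega>. R \<omega> $ i) \<in> borel_measurable M" for i
    using R_measurable by (rule borel_measurable_vec_component)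
  have "(\<lambda>\<omega>. G \<pi> (R \<omega>)) \<in> borel_measurable M"
    unfolding G_def using comp by (intro borel_measurable_vec) simp
  then have "(\<lambda>\<omega>. G \<pi> (R \<omega>)) \<in> measurable M (restrict_space borel prob_simplex)"
    using G_in_simplex[OF \<pi>] by (intro measurable_restrict_space2) auto
  moreover have "v \<in> borel_measurable (restrict_space borel prob_simplex)"
    using v by (intro borel_measurable_continuous_on_restrict) (simp add: Cb_def)
  ultimately have "(\<lambda>\<omega>. v (G \<pi> (R \<omega>))) \<in> borel_measurable M"
    by (rule measurable_compose)
  then show ?thesis unfolding log_wealth_def[abs_def] by measurable
qed

text \<open>The log-wealth lies between the smallest and the largest log-return up to the bound of \<open>v\<close>. The
  exponential moments of the smallest one also control its negative part, since
  \<open>x \<ge> - exp (- x)\<close>.\<close>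

lemma exp_moments_log_wealth:
  assumes v: "v \<in> Cb prob_simplex" and \<pi>: "\<pi> \<in> prob_simplex"
  shows "exp_moments M (log_wealth v \<pi>)"
proof -
  note [measurable] = log_wealth_measurable[OF assms]
  obtain K where K: "\<And>x. x \<in> prob_simplex \<Longrightarrow> \<bar>v x\<bar> \<le> K"
    using v by (auto simp: Cb_def bounded_iff)
  have bounds: "lo \<omega> - K \<le> log_wealth v \<pi> \<omega>" "log_wealth v \<pi> \<omega> \<le> hi \<omega> + K"
    if "\<omega> \<in> space M" for \<omega>
    using ln_inner_R_bounds[OF \<pi> that] K[OF G_in_simplex[OF \<pi> that]]
    by (auto simp: log_wealth_def abs_le_iff)
  have exp_lo: "integrable M (\<lambda>\<omega>. exp (\<gamma> * lo \<omega>))" if "\<gamma> < 0" for \<gamma>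
    using min_exp_integrable[OF that] by (simp add: lo_def)
  have hi: "integrable M hi" using max_integrable by (simp add: hi_def[abs_def])
  have "integrable M (\<lambda>\<omega>. exp (\<gamma> * log_wealth v \<pi> \<omega>))" if "\<gamma> < 0" for \<gamma>
  proof (rule Bochner_Integration.integrable_bound)
    show "integrable M (\<lambda>\<omega>. exp (- \<gamma> * K) * exp (\<gamma> * lo \<omega>))"
      using exp_lo[OF that] by simp
    show "AE \<omega> in M. norm (exp (\<gamma> * log_wealth v \<pi> \<omega>)) \<le> norm (exp (- \<gamma> * K) * exp (\<gamma> * lo \<omega>))"
    proof (rule AE_I2)
      fix \<omega> assume "\<omega> \<in> space M"
      then have "\<gamma> * log_wealth v \<pi> \<omega> \<le> \<gamma> * (lo \<omega> - K)"
        using bounds that by (intro mult_left_mono_neg) auto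
      then show "norm (exp (\<gamma> * log_wealth v \<pi> \<omega>)) \<le> norm (exp (- \<gamma> * K) * exp (\<gamma> * lo \<omega>))"
        by (simp add: exp_add[symmetric] algebra_simps)
    qed
  qed measurable
  moreover have "integrable M (log_wealth v \<pi>)"
  proof (rule Bochner_Integration.integrable_bound)
    show "integrable M (\<lambda>\<omega>. \<bar>hi \<omega>\<bar> + exp (-1 * lo \<omega>) + \<bar>K\<bar>)"
      using hi exp_lo[of "-1"] by (intro Bochner_Integration.integrable_add) auto
    show "AE \<omega> in M. norm (log_wealth v \<pi> \<omega>) \<le> norm (\<bar>hi \<omega>\<bar> + exp (-1 * lo \<omega>) + \<bar>K\<bar>)"
    proof (rule AE_I2)
      fix \<omega> assume "\<omega> \<in> space M"
      moreover have "- lo \<omega> \<le> exp (-1 * lo \<omega>)" "0 < exp (-1 * lo \<omega>)"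
        using exp_ge_add_one_self[of "- lo \<omega>"] by (simp_all only: mult_minus1 exp_gt_zero)
      ultimately show "norm (log_wealth v \<pi> \<omega>) \<le> norm (\<bar>hi \<omega>\<bar> + exp (-1 * lo \<omega>) + \<bar>K\<bar>)"
        using bounds[of \<omega>] unfolding real_norm_def by linarith
    qed
  qed measurable
  ultimately show ?thesis by (simp add: exp_moments_def)
qed

lemma reward_mono:
  assumes "v \<in> Cb prob_simplex" "v' \<in> Cb prob_simplex" "\<pi> \<in> prob_simplex"
    and "\<And>x. x \<in> prob_simplex \<Longrightarrow> v x \<le> v' x + k"
    and "\<gamma> \<le> \<gamma>'" "\<gamma>' \<le> 0"
  shows "reward \<gamma> v \<pi> \<le> reward \<gamma>' v' \<pi> + k"
  unfolding reward_def using assms G_in_simplex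
  by (intro entropic_mono exp_moments_log_wealth) (auto simp: log_wealth_def)

lemma reward_le:
  assumes v: "v \<in> Cb prob_simplex" "\<pi> \<in> prob_simplex" "\<gamma> \<le> 0"
    and le: "\<And>x. x \<in> prob_simplex \<Longrightarrow> v x \<le> k"
  shows "reward \<gamma> v \<pi> \<le> expectation hi + k"
proof -
  have "reward \<gamma> v \<pi> \<le> reward 0 (\<lambda>_. 0) \<pi> + k"
    using v le by (intro reward_mono) (auto simp: Cb_def bounded_iff)
  moreover have "reward 0 (\<lambda>_. 0) \<pi> \<le> expectation hi"
    unfolding reward_def entropic_def
    using exp_moments_log_wealth[of "\<lambda>_. 0" \<pi>] v ln_inner_R_bounds max_integrable
    by (auto intro!: integral_mono simp: exp_moments_def Cb_def bounded_iff log_wealth_def hi_def[abs_def])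
  ultimately show ?thesis by simp
qed


section \<open>The Bellman equation as a least upper bound\<close>

text \<open>The Bellman equation with the product of the growth rate and the mean waiting time merged into
  the single constant \<open>l\<close>.\<close>

definition solves :: "real \<Rightarrow> (real ^ 'n \<Rightarrow> real) \<Rightarrow> real \<Rightarrow> bool" where
  "solves \<gamma> v l \<longleftrightarrow> v \<in> Cb prob_simplex \<and>
     (\<forall>\<pi>\<in>prob_simplex. v \<pi> =
        (SUP \<pi>'\<in>prob_simplex. ln (shrink c h \<pi> \<pi>') - l + reward \<gamma> v \<pi>'))"

text \<open>Since \<open>Sup\<close> on the reals is meaningful only for non-empty sets that are bounded above, these
  side conditions are discharged here once and for all; later arguments use the two halves of the
  characterisation, \<open>solves_upper\<close> and \<open>solves_least\<close>.\<close>

lemma solves_iff: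
  assumes "\<gamma> \<le> 0"
  shows "solves \<gamma> v l \<longleftrightarrow> v \<in> Cb prob_simplex \<and>
    (\<forall>\<pi>\<in>prob_simplex.
      (\<forall>\<pi>'\<in>prob_simplex. ln (shrink c h \<pi> \<pi>') + reward \<gamma> v \<pi>' \<le> v \<pi> + l) \<and>
      (\<forall>b. (\<forall>\<pi>'\<in>prob_simplex. ln (shrink c h \<pi> \<pi>') + reward \<gamma> v \<pi>' \<le> b) \<longrightarrow> v \<pi> + l \<le> b))"
    (is "_ \<longleftrightarrow> _ \<and> (\<forall>\<pi>\<in>prob_simplex. ?lub \<pi>)")
proof (cases "v \<in> Cb prob_simplex")
  case True
  have "v \<pi> = (SUP \<pi>'\<in>prob_simplex. ln (shrink c h \<pi> \<pi>') - l + reward \<gamma> v \<pi>') \<longleftrightarrow> ?lub \<pi>"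
    (is "v \<pi> = Sup (?f ` _) \<longleftrightarrow> _") if \<pi>: "\<pi> \<in> prob_simplex" for \<pi>
  proof -
    obtain K where K: "\<And>x. x \<in> prob_simplex \<Longrightarrow> \<bar>v x\<bar> \<le> K"
      using True by (auto simp: Cb_def bounded_iff)
    have bdd: "bdd_above (?f ` prob_simplex)"
    proof (intro bdd_aboveI2)
      fix \<pi>' :: "real ^ 'n" assume \<pi>': "\<pi>' \<in> prob_simplex"
      have "reward \<gamma> v \<pi>' \<le> expectation hi + K"
        using K by (intro reward_le True \<pi>' assms) (auto simp: abs_le_iff)
      then show "?f \<pi>' \<le> expectation hi + K - l"
        using ln_shrink_nonpos[OF \<pi> \<pi>'] by simp
    qed
    show ?thesis
    proof
      assume eq: "v \<pi> = Sup (?f ` prob_simplex)"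
      show "?lub \<pi>"
      proof (intro conjI ballI allI impI)
        fix \<pi>' :: "real ^ 'n" assume "\<pi>' \<in> prob_simplex"
        then have "?f \<pi>' \<le> v \<pi>" unfolding eq by (intro cSUP_upper bdd)
        then show "ln (shrink c h \<pi> \<pi>') + reward \<gamma> v \<pi>' \<le> v \<pi> + l" by simp
      next
        fix b assume "\<forall>\<pi>'\<in>prob_simplex. ln (shrink c h \<pi> \<pi>') + reward \<gamma> v \<pi>' \<le> b"
        then have "v \<pi> \<le> b - l" unfolding eq by (intro cSUP_least simplex_nonempty) (auto simp: algebra_simps)
        then show "v \<pi> + l \<le> b" by simp
      qed
    next
      assume lub: "?lub \<pi>"
      show "v \<pi> = Sup (?f ` prob_simplex)"
      proof (rule antisym)
        have "ln (shrink c h \<pi> \<pi>') + reward \<gamma> v \<pi>' \<le> Sup (?f ` prob_simplex) + l"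
          if "\<pi>' \<in> prob_simplex" for \<pi>'
          using cSUP_upper[OF that bdd] by (simp add: algebra_simps)
        then have "v \<pi> + l \<le> Sup (?f ` prob_simplex) + l" using lub by blast
        then show "v \<pi> \<le> Sup (?f ` prob_simplex)" by simp
        show "Sup (?f ` prob_simplex) \<le> v \<pi>"
          using lub by (intro cSUP_least simplex_nonempty) (auto simp: algebra_simps)
      qed
    qed
  qed
  then show ?thesis using True unfolding solves_def by (metis (no_types, lifting))
qed (simp add: solves_def)

lemma solves_Cb: "solves \<gamma> v l \<Longrightarrow> v \<in> Cb prob_simplex"
  by (simp add: solves_def)

lemma solves_upper:
  assumes "solves \<gamma> v l" "\<gamma> \<le> 0" "\<pi> \<in> prob_simplex" "\<pi>' \<in> prob_simplex"
  shows "ln (shrink c h \<pi> \<pi>') + reward \<gamma> v \<pi>' \<le> v \<pi> + l"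
  using assms(1)[unfolded solves_iff[OF assms(2)]] assms(3,4) by blast

lemma solves_least:
  assumes "solves \<gamma> v l" "\<gamma> \<le> 0" "\<pi> \<in> prob_simplex"
    and "\<And>\<pi>'. \<pi>' \<in> prob_simplex \<Longrightarrow> ln (shrink c h \<pi> \<pi>') + reward \<gamma> v \<pi>' \<le> b"
  shows "v \<pi> + l \<le> b"
  using assms(1)[unfolded solves_iff[OF assms(2)]] assms(3,4) by blast

text \<open>A comparison argument at a maximum point \<open>p\<close> of \<open>v - v'\<close>: there \<open>v\<close> equals \<open>v'\<close> plus a constant
  by which \<open>v\<close> is dominated everywhere, so the constant cancels from the two equations and only
  \<open>l \<le> l'\<close> remains.\<close>

lemma solves_constant_mono:
  assumes s: "solves \<gamma> v l" and s': "solves \<gamma>' v' l'" and \<gamma>: "\<gamma> \<le> \<gamma>'" "\<gamma>' \<le> 0"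
  shows "l \<le> l'"
proof -
  have v: "v \<in> Cb prob_simplex" and v': "v' \<in> Cb prob_simplex"
    using s s' solves_Cb by auto
  have "continuous_on prob_simplex (\<lambda>x. v x - v' x)"
    using v v' by (auto simp: Cb_def intro: continuous_on_diff)
  then obtain p where p: "p \<in> prob_simplex" "\<And>x. x \<in> prob_simplex \<Longrightarrow> v x - v' x \<le> v p - v' p"
    using continuous_attains_sup[OF compact_simplex simplex_nonempty] by blast
  have "v p + l \<le> v' p + l' + (v p - v' p)"
  proof (rule solves_least[OF s _ p(1)])
    fix \<pi>' :: "real ^ 'n" assume \<pi>': "\<pi>' \<in> prob_simplex"
    have "reward \<gamma> v \<pi>' \<le> reward \<gamma>' v' \<pi>' + (v p - v' p)"
      using p(2) by (intro reward_mono v v' \<pi>' \<gamma>) (simp add: algebra_simps)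
    then show "ln (shrink c h p \<pi>') + reward \<gamma> v \<pi>' \<le> v' p + l' + (v p - v' p)"
      using solves_upper[OF s' \<gamma>(2) p(1) \<pi>'] by simp
  qed (use \<gamma> in simp)
  then show ?thesis by simp
qed

text \<open>The same argument with the constant zero function in place of \<open>v'\<close>.\<close>

lemma solves_constant_le:
  assumes s: "solves \<gamma> v l" and \<gamma>: "\<gamma> \<le> 0"
  shows "l \<le> expectation hi"
proof -
  have v: "v \<in> Cb prob_simplex" using s by (rule solves_Cb)
  then obtain p where p: "p \<in> prob_simplex" "\<And>x. x \<in> prob_simplex \<Longrightarrow> v x \<le> v p"
    using continuous_attains_sup[OF compact_simplex simplex_nonempty, of v] by (auto simp: Cb_def)
  have "v p + l \<le> expectation hi + v p"
  proof (rule solves_least[OF s \<gamma> p(1)])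
    fix \<pi>' :: "real ^ 'n" assume \<pi>': "\<pi>' \<in> prob_simplex"
    show "ln (shrink c h p \<pi>') + reward \<gamma> v \<pi>' \<le> expectation hi + v p"
      using reward_le[OF v \<pi>' \<gamma> p(2)] ln_shrink_nonpos[OF p(1) \<pi>'] by simp
  qed
  then show ?thesis by simp
qed

text \<open>Two positions may rebalance to the same target \<open>\<pi>'\<close>, and from then on their rewards agree; only
  the cost of the first rebalancing differs.\<close>

lemma solves_lipschitz:
  assumes s: "solves \<gamma> v l" and \<gamma>: "\<gamma> \<le> 0"
    and \<pi>: "\<pi> \<in> prob_simplex" and \<rho>: "\<rho> \<in> prob_simplex"
  shows "\<bar>v \<pi> - v \<rho>\<bar> \<le> lip * dist \<pi> \<rho>"
proof -
  have "v \<pi> + l \<le> v \<rho> + l + lip * dist \<pi> \<rho>"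
    if \<pi>: "\<pi> \<in> prob_simplex" and \<rho>: "\<rho> \<in> prob_simplex" for \<pi> \<rho>
  proof (rule solves_least[OF s \<gamma> \<pi>])
    fix \<pi>' :: "real ^ 'n" assume \<pi>': "\<pi>' \<in> prob_simplex"
    show "ln (shrink c h \<pi> \<pi>') + reward \<gamma> v \<pi>' \<le> v \<rho> + l + lip * dist \<pi> \<rho>"
      using ln_shrink_le[OF \<pi> \<rho> \<pi>'] solves_upper[OF s \<gamma> \<rho> \<pi>'] by simp
  qed
  from this[OF \<pi> \<rho>] this[OF \<rho> \<pi>] show ?thesis
    by (simp add: dist_commute abs_le_iff)
qed

lemma solves_add_const:
  assumes s: "solves \<gamma> v l" and \<gamma>: "\<gamma> \<le> 0"
  shows "solves \<gamma> (\<lambda>x. v x + k) l"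
proof -
  have v: "v \<in> Cb prob_simplex" using s by (rule solves_Cb)
  then have vk: "(\<lambda>x. v x + k) \<in> Cb prob_simplex"
    using bounded_translation[of "v ` prob_simplex" k]
    by (auto simp: Cb_def image_image add.commute intro!: continuous_intros)
  have shift: "reward \<gamma> (\<lambda>x. v x + k) \<pi>' = reward \<gamma> v \<pi>' + k" if "\<pi>' \<in> prob_simplex" for \<pi>'
    using reward_mono[OF vk v that, of k \<gamma> \<gamma>] reward_mono[OF v vk that, of "-k" \<gamma> \<gamma>] \<gamma> by simp
  show ?thesis
    unfolding solves_iff[OF \<gamma>]
  proof (intro conjI ballI allI impI vk)
    fix \<pi> \<pi>' :: "real ^ 'n" assume "\<pi> \<in> prob_simplex" "\<pi>' \<in> prob_simplex"
    then show "ln (shrink c h \<pi> \<pi>') + reward \<gamma> (\<lambda>x. v x + k) \<pi>' \<le> v \<pi> + k + l"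
      using solves_upper[OF s \<gamma>, of \<pi> \<pi>'] shift by simp
  next
    fix \<pi> :: "real ^ 'n" and b
    assume \<pi>: "\<pi> \<in> prob_simplex"
      and b: "\<forall>\<pi>'\<in>prob_simplex. ln (shrink c h \<pi> \<pi>') + reward \<gamma> (\<lambda>x. v x + k) \<pi>' \<le> b"
    have "v \<pi> + l \<le> b - k"
      using b shift by (intro solves_least[OF s \<gamma> \<pi>]) (auto simp: algebra_simps)
    then show "v \<pi> + k + l \<le> b" by simp
  qed
qed

section \<open>The vanishing risk-aversion limit\<close>

text \<open>Stability of the equation. The two halves of the least-upper-bound characterisation use the two
  halves of the convergence of the entropic utility to the expectation: the upper bound the pointwise
  convergence, the leastness the inequality \<open>reward \<gamma> \<le> reward 0\<close>.\<close>

lemma solves_limit: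
  assumes s: "\<And>n. solves (g n) (v n) (l n)"
    and g: "g \<longlonglongrightarrow> 0" "\<And>n. g n < 0"
    and l: "l \<longlonglongrightarrow> l\<^sub>0"
    and v: "uniform_limit prob_simplex v v\<^sub>0 sequentially"
  shows "solves 0 v\<^sub>0 l\<^sub>0"
proof -
  have g0: "g n \<le> 0" for n using g(2) by (rule less_imp_le)
  have vC: "v n \<in> Cb prob_simplex" for n using s by (rule solves_Cb)
  have cont: "continuous_on prob_simplex v\<^sub>0"
    using vC by (intro uniform_limit_theorem[OF _ v]) (auto simp: Cb_def)
  then have v0: "v\<^sub>0 \<in> Cb prob_simplex"
    using compact_imp_bounded[OF compact_continuous_image[OF cont compact_simplex]]
    by (simp add: Cb_def)
  have lim: "(\<lambda>n. v n \<pi> + l n) \<longlonglongrightarrow> v\<^sub>0 \<pi> + l\<^sub>0" if "\<pi> \<in> prob_simplex" for \<pi>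
    using tendsto_uniform_limitI[OF v that] l by (rule tendsto_add)
  have close: "\<forall>\<^sub>F n in sequentially. \<forall>x\<in>prob_simplex. v n x \<le> v\<^sub>0 x + e \<and> v\<^sub>0 x \<le> v n x + e"
    if "0 < e" for e
    using uniform_limitD[OF v that] by eventually_elim (force simp: dist_real_def abs_less_iff)
  show ?thesis
    unfolding solves_iff[OF order_refl]
  proof (intro conjI ballI allI impI v0)
    fix \<pi> \<pi>' :: "real ^ 'n" assume \<pi>: "\<pi> \<in> prob_simplex" and \<pi>': "\<pi>' \<in> prob_simplex"
    have rew: "(\<lambda>n. reward (g n) v\<^sub>0 \<pi>') \<longlonglongrightarrow> reward 0 v\<^sub>0 \<pi>'"
      using entropic_tendsto_expectation[OF exp_moments_log_wealth[OF v0 \<pi>'] g]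
      by (simp add: reward_def entropic_def)
    show "ln (shrink c h \<pi> \<pi>') + reward 0 v\<^sub>0 \<pi>' \<le> v\<^sub>0 \<pi> + l\<^sub>0"
    proof (rule field_le_epsilon)
      fix e :: real assume "0 < e"
      show "ln (shrink c h \<pi> \<pi>') + reward 0 v\<^sub>0 \<pi>' \<le> v\<^sub>0 \<pi> + l\<^sub>0 + e"
      proof (rule tendsto_le)
        show "(\<lambda>n. ln (shrink c h \<pi> \<pi>') + reward (g n) v\<^sub>0 \<pi>')
            \<longlonglongrightarrow> ln (shrink c h \<pi> \<pi>') + reward 0 v\<^sub>0 \<pi>'"
          by (intro tendsto_add tendsto_const rew)
        show "(\<lambda>n. v n \<pi> + l n + e) \<longlonglongrightarrow> v\<^sub>0 \<pi> + l\<^sub>0 + e"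
          by (intro tendsto_add[OF lim[OF \<pi>]] tendsto_const)
        show "\<forall>\<^sub>F n in sequentially.
            ln (shrink c h \<pi> \<pi>') + reward (g n) v\<^sub>0 \<pi>' \<le> v n \<pi> + l n + e"
          using close[OF \<open>0 < e\<close>]
        proof eventually_elim
          fix n assume "\<forall>x\<in>prob_simplex. v n x \<le> v\<^sub>0 x + e \<and> v\<^sub>0 x \<le> v n x + e"
          then have "reward (g n) v\<^sub>0 \<pi>' \<le> reward (g n) (v n) \<pi>' + e"
            by (intro reward_mono v0 vC \<pi>' g0) auto
          then show "ln (shrink c h \<pi> \<pi>') + reward (g n) v\<^sub>0 \<pi>' \<le> v n \<pi> + l n + e"
            using solves_upper[OF s[of n] g0[of n] \<pi> \<pi>'] by linarith
        qed
      qed simp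
    qed
  next
    fix \<pi> :: "real ^ 'n" and b
    assume \<pi>: "\<pi> \<in> prob_simplex"
      and b: "\<forall>\<pi>'\<in>prob_simplex. ln (shrink c h \<pi> \<pi>') + reward 0 v\<^sub>0 \<pi>' \<le> b"
    show "v\<^sub>0 \<pi> + l\<^sub>0 \<le> b"
    proof (rule field_le_epsilon)
      fix e :: real assume "0 < e"
      show "v\<^sub>0 \<pi> + l\<^sub>0 \<le> b + e"
      proof (rule tendsto_upperbound[OF lim[OF \<pi>]])
        show "\<forall>\<^sub>F n in sequentially. v n \<pi> + l n \<le> b + e"
          using close[OF \<open>0 < e\<close>]
        proof eventually_elim
          fix n assume cl: "\<forall>x\<in>prob_simplex. v n x \<le> v\<^sub>0 x + e \<and> v\<^sub>0 x \<le> v n x + e"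
          show "v n \<pi> + l n \<le> b + e"
          proof (rule solves_least[OF s g0 \<pi>])
            fix \<pi>' :: "real ^ 'n" assume \<pi>': "\<pi>' \<in> prob_simplex"
            have "reward (g n) (v n) \<pi>' \<le> reward 0 v\<^sub>0 \<pi>' + e"
              using cl by (intro reward_mono v0 vC \<pi>' g0) auto
            then show "ln (shrink c h \<pi> \<pi>') + reward (g n) (v n) \<pi>' \<le> b + e"
              using bspec[OF b \<pi>'] by linarith
          qed
        qed
      qed simp
    qed
  qed
qed

text \<open>The solutions need not be bounded uniformly in \<open>n\<close>, but the equation is invariant under adding
  constants, so they may be normalised to vanish at a point \<open>p\<close>. The uniform Lipschitz constant then
  bounds them and makes them equicontinuous.\<close>

lemma solves_compactness:
  assumes s: "\<And>n. solves (g n) (v n) (l n)"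
    and g: "g \<longlonglongrightarrow> 0" "\<And>n. g n < 0"
    and l: "l \<longlonglongrightarrow> l\<^sub>0"
  shows "\<exists>v\<^sub>0. solves 0 v\<^sub>0 l\<^sub>0"
proof -
  obtain p where p: "p \<in> (prob_simplex :: (real ^ 'n) set)" using simplex_nonempty by blast
  define w where "w n x = v n x + (- v n p)" for n x
  have g0: "g n \<le> 0" for n using g(2) by (rule less_imp_le)
  have w: "solves (g n) (w n) (l n)" for n
    unfolding w_def by (rule solves_add_const[OF s g0])
  have lipschitz: "\<bar>w n x - w n y\<bar> \<le> lip * dist x y"
    if "x \<in> prob_simplex" "y \<in> prob_simplex" for n x y
    using solves_lipschitz[OF w g0 that] .
  obtain D where D: "\<And>x. x \<in> prob_simplex \<Longrightarrow> dist x p \<le> D"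
    using compact_imp_bounded[OF compact_simplex] by (metis bounded_any_center dist_commute)
  obtain w\<^sub>0 k where k: "strict_mono (k :: nat \<Rightarrow> nat)"
    and conv: "\<And>e. 0 < e \<Longrightarrow> \<exists>N. \<forall>n x. N \<le> n \<and> x \<in> prob_simplex \<longrightarrow> norm (w (k n) x - w\<^sub>0 x) < e"
  proof (rule Arzela_Ascoli[OF compact_simplex, of w "lip * D"])
    fix n and x :: "real ^ 'n" assume x: "x \<in> prob_simplex"
    have "\<bar>w n x - w n p\<bar> \<le> lip * dist x p" by (rule lipschitz[OF x p])
    also have "\<dots> \<le> lip * D" using D[OF x] lip_pos by (intro mult_left_mono) auto
    finally show "norm (w n x) \<le> lip * D" by (simp add: w_def)
  next
    fix x :: "real ^ 'n" and e :: real assume x: "x \<in> prob_simplex" and e: "0 < e"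
    have "norm (w n x - w n y) < e" if "y \<in> prob_simplex" "norm (x - y) < e / lip" for n y
      using lipschitz[OF x that(1), of n] that(2) lip_pos
      by (simp add: dist_norm pos_less_divide_eq mult.commute)
    then show "\<exists>d>0. \<forall>n y. y \<in> prob_simplex \<and> norm (x - y) < d \<longrightarrow> norm (w n x - w n y) < e"
      using e lip_pos by (intro exI[of _ "e / lip"]) auto
  qed blast
  have "uniform_limit prob_simplex (\<lambda>n. w (k n)) w\<^sub>0 sequentially"
    unfolding uniform_limit_iff eventually_sequentially dist_norm using conv by blast
  moreover have "(\<lambda>n. g (k n)) \<longlonglongrightarrow> 0" "(\<lambda>n. l (k n)) \<longlonglongrightarrow> l\<^sub>0"
    using LIMSEQ_subseq_LIMSEQ[OF g(1) k] LIMSEQ_subseq_LIMSEQ[OF l k] by (simp_all add: o_def)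
  ultimately have "solves 0 w\<^sub>0 l\<^sub>0"
    using w g(2) by (intro solves_limit[where g = "\<lambda>n. g (k n)" and v = "\<lambda>n. w (k n)" and l = "\<lambda>n. l (k n)"])
  then show ?thesis by blast
qed

text \<open>A bounded non-decreasing function has a left limit, namely its supremum; this identifies
  \<open>Lim (at_left 0) lam\<close>, after which any sequence tending to \<open>0\<close> from the left will do.\<close>

lemma solves_vanishing_limit:
  assumes ex: "\<And>\<gamma>. \<gamma> < 0 \<Longrightarrow> \<exists>v. solves \<gamma> v (lam \<gamma> * \<kappa>)" and \<kappa>: "0 < \<kappa>"
  shows "(lam \<longlongrightarrow> Lim (at_left 0) lam) (at_left 0) \<and> (\<exists>v\<^sub>0. solves 0 v\<^sub>0 (Lim (at_left 0) lam * \<kappa>))"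
proof -
  have mono: "lam \<gamma> \<le> lam \<gamma>'" if \<gamma>: "\<gamma> \<le> \<gamma>'" "\<gamma>' < 0" for \<gamma> \<gamma>'
  proof -
    obtain v v' where "solves \<gamma> v (lam \<gamma> * \<kappa>)" "solves \<gamma>' v' (lam \<gamma>' * \<kappa>)"
      using ex \<gamma> by (meson le_less_trans)
    then have "lam \<gamma> * \<kappa> \<le> lam \<gamma>' * \<kappa>" using solves_constant_mono \<gamma> by auto
    then show ?thesis using \<kappa> by simp
  qed
  have bdd: "bdd_above (lam ` {..<0})"
  proof (rule bdd_aboveI2)
    fix \<gamma> :: real assume "\<gamma> \<in> {..<0}"
    then have "lam \<gamma> * \<kappa> \<le> expectation hi" using ex solves_constant_le by force
    then show "lam \<gamma> \<le> expectation hi / \<kappa>" using \<kappa> by (simp add: pos_le_divide_eq)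
  qed
  define L where "L = (SUP \<gamma>\<in>{..<0}. lam \<gamma>)"
  have le_L: "lam \<gamma> \<le> L" if "\<gamma> < 0" for \<gamma>
    unfolding L_def using that by (intro cSUP_upper bdd) auto
  have tendsto: "(lam \<longlongrightarrow> L) (at_left 0)"
  proof (rule order_tendstoI)
    fix a assume a: "L < a"
    have "\<forall>\<^sub>F \<gamma> in at_left 0. \<gamma> \<in> {-1<..<(0::real)}"
      by (rule eventually_at_left_real) simp
    then show "\<forall>\<^sub>F \<gamma> in at_left 0. lam \<gamma> < a"
      by eventually_elim (use le_L a in \<open>force intro: le_less_trans\<close>)
  next
    fix a assume "a < L"
    then have "\<exists>\<gamma>\<in>{..<0}. a < lam \<gamma>"
      unfolding L_def by (subst (asm) less_cSUP_iff[OF _ bdd]) auto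
    then obtain \<gamma>\<^sub>0 where \<gamma>\<^sub>0: "\<gamma>\<^sub>0 < 0" "a < lam \<gamma>\<^sub>0" by auto
    have "\<forall>\<^sub>F \<gamma> in at_left 0. \<gamma> \<in> {\<gamma>\<^sub>0<..<0}"
      using \<gamma>\<^sub>0(1) by (rule eventually_at_left_real)
    then show "\<forall>\<^sub>F \<gamma> in at_left 0. a < lam \<gamma>"
      by eventually_elim (use mono[of \<gamma>\<^sub>0] \<gamma>\<^sub>0 in \<open>force intro: less_le_trans\<close>)
  qed
  then have L: "Lim (at_left 0) lam = L" by (intro tendsto_Lim) auto
  define g :: "nat \<Rightarrow> real" where "g n = - (1 / real (Suc n))" for n
  have g: "g \<longlonglongrightarrow> 0" "g n < 0" for n
    using tendsto_minus[OF LIMSEQ_Suc[OF lim_1_over_n]] by (auto simp: g_def[abs_def])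
  have "filterlim g (at_left 0) sequentially"
    using g by (auto simp: filterlim_at less_imp_neq)
  then have "(\<lambda>n. lam (g n)) \<longlonglongrightarrow> L" by (rule filterlim_compose[OF tendsto])
  then have lim: "(\<lambda>n. lam (g n) * \<kappa>) \<longlonglongrightarrow> L * \<kappa>" by (intro tendsto_mult tendsto_const)
  have "\<forall>n. \<exists>v. solves (g n) v (lam (g n) * \<kappa>)" using ex g(2) by blast
  from choice[OF this] obtain v where "\<forall>n. solves (g n) (v n) (lam (g n) * \<kappa>)" ..
  then have "\<And>n. solves (g n) (v n) (lam (g n) * \<kappa>)" by blast
  from solves_compactness[OF this g lim] tendsto show ?thesis by (simp add: L)
qed

end

section \<open>Existence for the risk-neutral equation\<close>

theorem theorem4p1:
  fixes M :: "'w measure"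
    and S :: "real \<Rightarrow> 'w \<Rightarrow> real ^ 'n"
    and \<eta> :: "nat \<Rightarrow> 'w \<Rightarrow> real"
    and c h :: "real ^ 'n"
    and lam :: "real \<Rightarrow> real"
  assumes "prob_space M"
    and "\<forall>i. 0 \<le> c $ i \<and> c $ i < 1"
    and "\<forall>i. 0 \<le> h $ i \<and> h $ i < 1"
    and "price_process M S"
    and "iid_positive M \<eta>"
    and "indep_of_prices M S \<eta>"
    and "increments_cond M S"
    and "waiting_cond M \<eta>"
    and "integrability_cond M S \<eta>"
    and "\<forall>\<gamma><0. \<exists>v. bellman_solution M S \<eta> c h \<gamma> v (lam \<gamma>)"
  shows "(lam \<longlongrightarrow> Lim (at_left 0) lam) (at_left 0) \<and>
         (\<exists>v\<^sub>0. bellman_solution M S \<eta> c h 0 v\<^sub>0 (Lim (at_left 0) lam))"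
proof -
  interpret prob_space M by fact
  define R where "R \<omega> = price_rel S 0 (\<eta> 1 \<omega>) \<omega>" for \<omega>
  define \<kappa> where "\<kappa> = expectation (\<eta> 1)"
  have \<eta>_int: "integrable M (\<eta> 1)" using assms(8) by (simp add: waiting_cond_def)
  have \<eta>_pos: "0 < \<eta> 1 \<omega>" if "\<omega> \<in> space M" for \<omega>
    using assms(5) that by (auto simp: iid_positive_def)
  have \<kappa>: "0 < \<kappa>"
    unfolding \<kappa>_def using \<eta>_int \<eta>_pos by (intro expectation_greater) auto
  have ln_R: "($) (log_price_rel S (\<eta> 1 \<omega>) \<omega>) = (\<lambda>i. ln (R \<omega> $ i))" for \<omega>
    by (rule ext) (simp add: log_price_rel_def vec_ln_def R_def)
  interpret growth_market M c h R
  proof unfold_locales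
    show "R \<in> borel_measurable M"
      unfolding R_def[abs_def] using \<eta>_int \<eta>_pos
      by (intro price_rel_measurable assms) (auto intro: less_imp_le)
    show "0 < R \<omega> $ i" if "\<omega> \<in> space M" for \<omega> i
      using assms(4) \<eta>_pos[OF that] that
      by (auto simp: R_def price_rel_def price_process_def intro!: divide_pos_pos less_imp_le)
    show "integrable M (\<lambda>\<omega>. exp (\<gamma> * (MIN i. ln (R \<omega> $ i))))" if "\<gamma> < 0" for \<gamma>
      using assms(9) that unfolding integrability_cond_def ln_R by blast
    show "integrable M (\<lambda>\<omega>. MAX i. ln (R \<omega> $ i))"
      using assms(9) unfolding integrability_cond_def ln_R by blast
  qed (use assms(2,3) in auto)
  have bellman: "bellman_solution M S \<eta> c h \<gamma> v l \<longleftrightarrow> solves \<gamma> v (l * \<kappa>)" for \<gamma> v l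
    by (simp add: bellman_solution_def solves_def reward_def log_wealth_def[abs_def] R_def \<kappa>_def)
  show ?thesis
    unfolding bellman
    by (rule solves_vanishing_limit[OF _ \<kappa>]) (use assms(10) bellman in blast)
qed

end
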